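(* Let $n\ge 4$ be an integer and let $W_n$ be the wheel graph on $n$ vertices. Then $$\mathscr{D}_1(W_n)=\begin{cases}0 & \text{if } n\equiv 2\pmod 4,\\ 1 & \text{if } n\equiv 1,3\pmod 4,\\ 2 & \text{if } n\equiv 0\pmod 4,\end{cases}\qquad\text{and}\qquad \mathscr{D}_2(W_n)=\begin{cases}0 & \text{if } n\not\equiv 0\pmod 4,\\ 2 & \text{if } n\equiv 0\pmod 4.\end{cases}$$
   Context: All graphs are finite and simple. For a graph $G$ and a labelling $f: V(G)\to\{0,1\}$, the induced edge labelling is $\overline{f}(xy)=|f(x)-f(y)|$ for $xy\in E(G)$. For $i\in\{0,1\}$, $v_i(f)$ is the number of vertices with label $i$ and $e_i(f)$ is the number of edges with induced label $i$. Put $\Delta_v(f)=|v_0(f)-v_1(f)|$ and $\Delta_e(f)=|e_0(f)-e_1(f)|$. Define $$\mathscr{D}_1(G)=\min_{f}\{\Delta_v(f)+\Delta_e(f)\},\qquad \mathscr{D}_2(G)=\min_{f:\,\Delta_v(f)\le 1}\{\Delta_e(f)\},$$ where the first minimum is over all labellings $f:V(G)\to\{0,1\}$ and the second is over those with $\Delta_v(f)\le 1$. The wheel graph $W_n$ is the $n$-vertex graph consisting of a cycle $C_{n-1}$ on $n-1$ vertices together with one further (central) vertex adjacent to every vertex of the cycle; it has $2n-2$ edges. *)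

theory Defs
  imports Main "HOL-Library.FuncSet"
begin

record 'a graph =
  verts :: "'a set"
  edges :: "'a set set"

text \<open>Undirected edges are two-element sets of vertices, so loops and multiple edges are excluded.\<close>

definition finite_simple_graph :: "'a graph \<Rightarrow> bool" where
  "finite_simple_graph G \<longleftrightarrow>
     finite (verts G) \<and> (\<forall>e\<in>edges G. e \<subseteq> verts G \<and> card e = 2)"

definition labellings :: "'a graph \<Rightarrow> ('a \<Rightarrow> int) set" where
  "labellings G = verts G \<rightarrow>\<^sub>E {0, 1}"

text \<open>The description determines a unique value because \<open>\<bar>f x - f y\<bar>\<close> is symmetric in the two
  endpoints; see \<open>edge_label_insert\<close> below.\<close>

definition edge_label :: "('a \<Rightarrow> int) \<Rightarrow> 'a set \<Rightarrow> int" where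
  "edge_label f e = (THE l. \<exists>x y. e = {x, y} \<and> l = \<bar>f x - f y\<bar>)"

definition v_count :: "'a graph \<Rightarrow> int \<Rightarrow> ('a \<Rightarrow> int) \<Rightarrow> nat" where
  "v_count G i f = card {x \<in> verts G. f x = i}"

definition e_count :: "'a graph \<Rightarrow> int \<Rightarrow> ('a \<Rightarrow> int) \<Rightarrow> nat" where
  "e_count G i f = card {e \<in> edges G. edge_label f e = i}"

definition Delta_v :: "'a graph \<Rightarrow> ('a \<Rightarrow> int) \<Rightarrow> int" where
  "Delta_v G f = \<bar>int (v_count G 0 f) - int (v_count G 1 f)\<bar>"

definition Delta_e :: "'a graph \<Rightarrow> ('a \<Rightarrow> int) \<Rightarrow> int" where
  "Delta_e G f = \<bar>int (e_count G 0 f) - int (e_count G 1 f)\<bar>"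

text \<open>For a finite graph both minima range over finite nonempty sets
  (\<open>finite_labellings\<close>, \<open>balanced_labelling_exists\<close> below), so \<open>Min\<close> is the true minimum.\<close>

definition D1 :: "'a graph \<Rightarrow> int" where
  "D1 G = Min ((\<lambda>f. Delta_v G f + Delta_e G f) ` labellings G)"

definition D2 :: "'a graph \<Rightarrow> int" where
  "D2 G = Min (Delta_e G ` {f \<in> labellings G. Delta_v G f \<le> 1})"

text \<open>This is a cycle only for \<open>k \<ge> 3\<close>.\<close>

definition cycle_graph :: "nat \<Rightarrow> nat graph" where
  "cycle_graph k = \<lparr>verts = {..<k}, edges = (\<lambda>i. {i, (i + 1) mod k}) ` {..<k}\<rparr>"

text \<open>The index is the total number of vertices: the rim is the cycle on \<open>0, \<dots>, n - 2\<close> and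
  the central vertex is \<open>n - 1\<close>. Meaningful for \<open>n \<ge> 4\<close>.\<close>

definition wheel_graph :: "nat \<Rightarrow> nat graph" where
  "wheel_graph n =
     \<lparr>verts = insert (n - 1) (verts (cycle_graph (n - 1))),
      edges = edges (cycle_graph (n - 1)) \<union> (\<lambda>i. {n - 1, i}) ` verts (cycle_graph (n - 1))\<rparr>"

lemma edge_label_insert: "edge_label f {x, y} = \<bar>f x - f y\<bar>"
  unfolding edge_label_def by (rule the_equality) (auto simp: doubleton_eq_iff abs_minus_commute)

lemma finite_labellings: "finite (verts G) \<Longrightarrow> finite (labellings G)"
  unfolding labellings_def by (intro finite_PiE) auto

lemma balanced_labelling_exists:
  assumes "finite (verts G)"
  shows "\<exists>f \<in> labellings G. Delta_v G f \<le> 1"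
proof -
  obtain A where A: "A \<subseteq> verts G" "card A = card (verts G) div 2"
    by (meson div_le_dividend obtain_subset_with_card_n)
  define f where "f = (\<lambda>x. if x \<in> verts G then (if x \<in> A then 1 else 0 :: int) else undefined)"
  have 1: "{x \<in> verts G. f x = 1} = A" "{x \<in> verts G. f x = 0} = verts G - A"
    using A(1) by (auto simp: f_def)
  have "card (verts G - A) = card (verts G) - card (verts G) div 2"
    using A assms by (metis card_Diff_subset finite_subset)
  hence "Delta_v G f \<le> 1"
    unfolding Delta_v_def v_count_def 1 A(2) by linarith
  moreover have "f \<in> labellings G"
    by (auto simp: labellings_def f_def split: if_splits)
  ultimately show ?thesis by blast
qed

lemma wheel_graph_simple:
  assumes "n \<ge> 4"
  shows "finite_simple_graph (wheel_graph n)" "card (verts (wheel_graph n)) = n"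
proof -
  have ne: "(i + 1) mod (n - 1) \<noteq> i" if "i < n - 1" for i
    using that assms by (cases "i + 1 = n - 1") auto
  show "finite_simple_graph (wheel_graph n)"
    using assms ne
    by (auto simp: finite_simple_graph_def wheel_graph_def cycle_graph_def card_2_iff
        doubleton_eq_iff less_imp_neq intro!: exI)
  show "card (verts (wheel_graph n)) = n"
    using assms by (simp add: wheel_graph_def cycle_graph_def)
qed

lemma card_edges_wheel_graph:
  assumes "n \<ge> 4"
  shows "card (edges (wheel_graph n)) = 2 * n - 2"
proof -
  define k where "k = n - 1"
  have k: "k \<ge> 3" using assms by (simp add: k_def)
  have s: "Suc i mod k = (if Suc i = k then 0 else Suc i)" if "i < k" for i
    using that by auto
  have "inj_on (\<lambda>i. {i, (i + 1) mod k}) {..<k}"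
  proof (rule inj_onI)
    fix i j assume "i \<in> {..<k}" "j \<in> {..<k}" "{i, (i + 1) mod k} = {j, (j + 1) mod k}"
    thus "i = j"
      using k s[of i] s[of j] by (auto simp: doubleton_eq_iff split: if_splits)
  qed
  hence 1: "card ((\<lambda>i. {i, (i + 1) mod k}) ` {..<k}) = k"
    by (simp add: card_image)
  have 2: "card ((\<lambda>i. {k, i}) ` {..<k}) = k"
    by (subst card_image) (auto intro!: inj_onI simp: doubleton_eq_iff)
  have 3: "(\<lambda>i. {i, (i + 1) mod k}) ` {..<k} \<inter> (\<lambda>i. {k, i}) ` {..<k} = {}"
    using k by (auto simp: doubleton_eq_iff s split: if_splits)
  have "card (edges (wheel_graph n)) = k + k"
    using card_Un_disjoint[OF _ _ 3] 1 2
    by (simp add: wheel_graph_def cycle_graph_def k_def)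
  thus ?thesis using assms by (simp add: k_def)
qed

end

theory Submission
  imports Defs
begin

text \<open>For a 0/1-labelling both defects are determined by sums: a graph with \<open>p\<close> vertices and \<open>q\<close>
  edges has \<open>\<Delta>\<^sub>v(f) = \<bar>p - 2 s\<bar>\<close> and \<open>\<Delta>\<^sub>e(f) = \<bar>q - 2 c\<bar>\<close>, where \<open>s\<close> is the sum of the vertex
  labels and \<open>c\<close> the sum of the edge labels. For the wheel \<open>p = n\<close> and \<open>q = 2n - 2\<close>.

  The lower bounds are parity facts. If \<open>n\<close> is odd, so is \<open>\<Delta>\<^sub>v\<close>. If \<open>4\<close> divides \<open>n\<close>, every vertex of
  the wheel has odd degree (\<open>3\<close> on the rim, \<open>n - 1\<close> in the centre). Since \<open>\<bar>a - b\<bar>\<close> and \<open>a + b\<close> have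
  the same parity, summing over the edges counts each vertex label as often as its degree, so
  \<open>c\<close> and \<open>s\<close> have the same parity (\<open>even_wheel_edge_sum_iff\<close>). A labelling with
  \<open>\<Delta>\<^sub>v = 0\<close> has the even sum \<open>s = n/2\<close>; then \<open>c\<close> is even too and cannot equal the odd number
  \<open>n - 1\<close>, so that the even number \<open>\<Delta>\<^sub>e\<close> is at least \<open>2\<close>. If \<open>\<Delta>\<^sub>v \<noteq> 0\<close>, then already \<open>\<Delta>\<^sub>v \<ge> 2\<close>.

  For the upper bounds, give the centre label \<open>0\<close>, and let the rim carry \<open>t\<close> ones grouped into \<open>r\<close>
  runs. Each run contributes two rim edges with label \<open>1\<close> and each one contributes its spoke, so
  \<open>s = t\<close> and \<open>c = 2r + t\<close> (\<open>wheel_labelling_with_runs\<close>). With \<open>r = \<lfloor>n/4\<rfloor>\<close> and \<open>t\<close> equal to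
  \<open>n/2\<close>, or for odd \<open>n\<close> to the even one of the two integers next to \<open>n/2\<close>, a single labelling
  attains both minima.\<close>

section \<open>Defects as label sums\<close>

lemma card_zero_one_fibres:
  fixes g :: "'a \<Rightarrow> int"
  assumes "finite A" "\<And>x. x \<in> A \<Longrightarrow> g x \<in> {0, 1}"
  shows "int (card {x \<in> A. g x = 1}) = sum g A"
    and "int (card {x \<in> A. g x = 0}) = int (card A) - sum g A"
proof -
  have "sum g A = (\<Sum>x\<in>A. if g x = 1 then 1 else 0)"
    using assms(2) by (intro sum.cong) auto
  also have "\<dots> = int (card {x \<in> A. g x = 1})"
    using assms(1) by (simp add: sum.If_cases Int_def)
  finally show 1: "int (card {x \<in> A. g x = 1}) = sum g A" by simp
  have "A = {x \<in> A. g x = 0} \<union> {x \<in> A. g x = 1}"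
    using assms(2) by auto
  hence "card A = card {x \<in> A. g x = 0} + card {x \<in> A. g x = 1}"
    using assms(1) by (subst (1) \<open>A = _\<close>, subst card_Un_disjoint) auto
  thus "int (card {x \<in> A. g x = 0}) = int (card A) - sum g A"
    using 1 by simp
qed

lemma Delta_v_eq_sum:
  assumes "finite (verts G)" "f \<in> labellings G"
  shows "Delta_v G f = \<bar>int (card (verts G)) - 2 * sum f (verts G)\<bar>"
proof -
  have "f x \<in> {0, 1}" if "x \<in> verts G" for x
    using assms(2) that by (auto simp: labellings_def PiE_def Pi_def)
  note card_zero_one_fibres[OF assms(1) this]
  thus ?thesis unfolding Delta_v_def v_count_def by simp
qed

lemma Delta_e_eq_sum:
  assumes "finite_simple_graph G" "f \<in> labellings G"
  shows "Delta_e G f = \<bar>int (card (edges G)) - 2 * sum (edge_label f) (edges G)\<bar>"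
proof -
  have fin: "finite (edges G)"
    using assms(1) unfolding finite_simple_graph_def
    by (intro finite_subset[of "edges G" "Pow (verts G)"]) auto
  have "edge_label f e \<in> {0, 1}" if "e \<in> edges G" for e
  proof -
    have "e \<subseteq> verts G" "card e = 2"
      using assms(1) that by (auto simp: finite_simple_graph_def)
    then obtain x y where e: "e = {x, y}" "x \<in> verts G" "y \<in> verts G"
      by (auto simp: card_2_iff)
    have "f x \<in> {0, 1}" "f y \<in> {0, 1}"
      using assms(2) e by (auto simp: labellings_def PiE_def Pi_def)
    thus ?thesis unfolding e(1) edge_label_insert by auto
  qed
  note card_zero_one_fibres[OF fin this]
  thus ?thesis unfolding Delta_e_def e_count_def by simp
qed

section \<open>Label sums of the wheel\<close>

lemma sum_wheel_verts:
  "sum f (verts (wheel_graph n)) = f (n - 1) + sum f {..<n - 1}"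
  by (simp add: wheel_graph_def cycle_graph_def)

lemma sum_wheel_edges:
  assumes "n \<ge> 4"
  shows "sum (edge_label f) (edges (wheel_graph n))
    = (\<Sum>i<n - 1. \<bar>f i - f (Suc i mod (n - 1))\<bar>) + (\<Sum>i<n - 1. \<bar>f (n - 1) - f i\<bar>)"
proof -
  define k where "k = n - 1"
  have k: "k \<ge> 3" using assms by (simp add: k_def)
  have s: "Suc i mod k = (if Suc i = k then 0 else Suc i)" if "i < k" for i
    using that by auto
  let ?rim = "\<lambda>i. {i, Suc i mod k}" and ?spoke = "\<lambda>i. {k, i}"
  have inj_rim: "inj_on ?rim {..<k}"
  proof (rule inj_onI)
    fix i j assume "i \<in> {..<k}" "j \<in> {..<k}" "?rim i = ?rim j"
    thus "i = j"
      using k s[of i] s[of j] by (auto simp: doubleton_eq_iff split: if_splits)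
  qed
  have inj_spoke: "inj_on ?spoke {..<k}"
    by (auto intro!: inj_onI simp: doubleton_eq_iff)
  have disj: "?rim ` {..<k} \<inter> ?spoke ` {..<k} = {}"
    using k by (auto simp: doubleton_eq_iff s split: if_splits)
  have "edges (wheel_graph n) = ?rim ` {..<k} \<union> ?spoke ` {..<k}"
    by (simp add: wheel_graph_def cycle_graph_def k_def)
  hence "sum (edge_label f) (edges (wheel_graph n))
      = sum (edge_label f) (?rim ` {..<k}) + sum (edge_label f) (?spoke ` {..<k})"
    using disj by (simp add: sum.union_disjoint)
  also have "\<dots> = (\<Sum>i<k. \<bar>f i - f (Suc i mod k)\<bar>) + (\<Sum>i<k. \<bar>f k - f i\<bar>)"
    by (simp add: sum.reindex[OF inj_rim] sum.reindex[OF inj_spoke] edge_label_insert)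
  finally show ?thesis unfolding k_def .
qed

lemma sum_cyclic_shift:
  fixes f :: "nat \<Rightarrow> 'a::comm_monoid_add"
  shows "(\<Sum>i<k. f (Suc i mod k)) = (\<Sum>i<k. f i)"
proof (cases k)
  case (Suc m)
  have "(\<Sum>i<Suc m. f (Suc i mod Suc m)) = (\<Sum>i<m. f (Suc i)) + f 0"
    by simp
  also have "\<dots> = (\<Sum>i<Suc m. f i)"
    by (simp only: sum.lessThan_Suc_shift add.commute)
  finally show ?thesis using Suc by simp
qed simp

text \<open>This is the handshake argument modulo \<open>2\<close>: for even \<open>n\<close> all degrees of the wheel are odd.\<close>

lemma even_wheel_edge_sum_iff:
  assumes "n \<ge> 4" "even n"
  shows "even (sum (edge_label f) (edges (wheel_graph n)))
    \<longleftrightarrow> even (sum f (verts (wheel_graph n)))"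
proof -
  define k where "k = n - 1"
  have "odd k" using assms by (simp add: k_def)
  \<comment> \<open>Replacing each \<open>\<bar>a - b\<bar>\<close> by \<open>a + b\<close> keeps the parity.\<close>
  have parity: "even (sum (\<lambda>i. \<bar>g i - h i\<bar>) A) \<longleftrightarrow> even (sum g A + sum h A)"
    for g h :: "nat \<Rightarrow> int" and A
    by (induction A rule: infinite_finite_induct) (simp_all, blast)
  have "even (sum (edge_label f) (edges (wheel_graph n)))
      \<longleftrightarrow> even ((sum f {..<k} + sum f {..<k}) + (int k * f k + sum f {..<k}))"
    unfolding sum_wheel_edges[OF assms(1)] k_def[symmetric]
    using parity[of f "\<lambda>i. f (Suc i mod k)" "{..<k}"] parity[of "\<lambda>_. f k" f "{..<k}"]
    by (auto simp: sum_cyclic_shift)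
  also have "\<dots> \<longleftrightarrow> even (f k + sum f {..<k})"
    using \<open>odd k\<close> by auto
  finally show ?thesis by (simp add: sum_wheel_verts k_def)
qed

section \<open>Defects of the wheel\<close>

lemma Delta_v_wheel:
  assumes "n \<ge> 4" "f \<in> labellings (wheel_graph n)"
  shows "Delta_v (wheel_graph n) f = \<bar>int n - 2 * sum f (verts (wheel_graph n))\<bar>"
  using Delta_v_eq_sum[OF _ assms(2)] wheel_graph_simple[OF assms(1)]
  by (simp add: finite_simple_graph_def)

lemma Delta_e_wheel:
  assumes "n \<ge> 4" "f \<in> labellings (wheel_graph n)"
  shows "Delta_e (wheel_graph n) f
    = 2 * \<bar>int n - 1 - sum (edge_label f) (edges (wheel_graph n))\<bar>"
proof -
  have "int (card (edges (wheel_graph n))) = 2 * int n - 2"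
    using card_edges_wheel_graph[OF assms(1)] assms(1) by simp
  moreover have "\<bar>2 * a - 2 - 2 * c\<bar> = 2 * \<bar>a - 1 - c\<bar>" for a c :: int
    by presburger
  ultimately show ?thesis
    using Delta_e_eq_sum[OF wheel_graph_simple(1)[OF assms(1)] assms(2)] by (simp only:)
qed

lemma balanced_wheel_edge_defect:
  assumes "4 dvd n" "n \<ge> 4" "f \<in> labellings (wheel_graph n)" "Delta_v (wheel_graph n) f \<le> 1"
  shows "Delta_e (wheel_graph n) f \<ge> 2"
proof -
  define s c where "s = sum f (verts (wheel_graph n))"
    and "c = sum (edge_label f) (edges (wheel_graph n))"
  have "\<bar>int n - 2 * s\<bar> \<le> 1"
    using Delta_v_wheel[OF assms(2,3)] assms(4) unfolding s_def by simp
  moreover have "4 dvd int n" using assms(1) by presburger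
  ultimately have "even s" by presburger
  hence "even c"
    using even_wheel_edge_sum_iff[OF assms(2), of f] assms(1) unfolding s_def c_def by auto
  hence "int n - 1 \<noteq> c" using \<open>4 dvd int n\<close> by presburger
  hence "2 \<le> 2 * \<bar>int n - 1 - c\<bar>" by presburger
  also have "\<dots> = Delta_e (wheel_graph n) f"
    unfolding Delta_e_wheel[OF assms(2,3)] c_def ..
  finally show ?thesis .
qed

text \<open>The rim reads \<open>0 1 0 1 \<dots> 0 1\<close> up to position \<open>2r - 1\<close>, and the run of ones ending there is
  prolonged by the \<open>t - r\<close> missing ones; the rest of the rim and the centre are \<open>0\<close>.\<close>

lemma wheel_labelling_with_runs:
  assumes "n \<ge> 4" "1 \<le> r" "r \<le> t" "r + t \<le> n - 1"
  shows "\<exists>f \<in> labellings (wheel_graph n).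
    Delta_v (wheel_graph n) f = \<bar>int n - 2 * int t\<bar> \<and>
    Delta_e (wheel_graph n) f = 2 * \<bar>int n - 1 - 2 * int r - int t\<bar>"
proof -
  define k where "k = n - 1"
  define S where "S = (\<lambda>j. 2 * j + 1) ` {..<r} \<union> {2 * r..<r + t}"
  define f :: "nat \<Rightarrow> int"
    where "f = (\<lambda>i. if i \<le> k then (if i \<in> S then 1 else 0) else undefined)"
  have mem_S: "i \<in> S \<longleftrightarrow> (odd i \<and> i < 2 * r) \<or> (2 * r \<le> i \<and> i < r + t)" for i
    by (auto simp: S_def elim!: oddE)
  have S_sub: "S \<subseteq> {..<k}"
    using assms by (auto simp: mem_S k_def)
  have card_S: "card S = t"
  proof -
    have "card S = card ((\<lambda>j::nat. 2 * j + 1) ` {..<r}) + card {2 * r..<r + t}"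
      unfolding S_def by (rule card_Un_disjoint) auto
    also have "card ((\<lambda>j::nat. 2 * j + 1) ` {..<r}) = r"
      by (subst card_image) (auto intro: inj_onI)
    finally show ?thesis using assms(3) by simp
  qed
  have lab: "f \<in> labellings (wheel_graph n)"
    by (auto simp: labellings_def wheel_graph_def cycle_graph_def f_def k_def
        PiE_def extensional_def split: if_splits)
  have centre: "f k = 0" using S_sub by (auto simp: f_def)
  have rim_sum: "sum f {..<k} = int t"
  proof -
    have "sum f {..<k} = (\<Sum>i<k. if i \<in> S then 1 else 0)"
      by (intro sum.cong) (auto simp: f_def)
    also have "\<dots> = int (card ({..<k} \<inter> S))" by (simp add: sum.If_cases)
    finally show ?thesis using S_sub card_S by (simp add: Int_absorb1)
  qed
  have cut_sum: "(\<Sum>i<k. \<bar>f i - f (Suc i mod k)\<bar>) = 2 * int r"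
  proof -
    \<comment> \<open>The label changes after each of the first \<open>2r - 1\<close> rim positions and at the end of the
      last run, cyclically if that run reaches the end of the rim.\<close>
    let ?C = "insert (r + t - 1) {..<2 * r - 1}"
    have change: "(i \<in> S) \<noteq> (Suc i mod k \<in> S) \<longleftrightarrow> i \<in> ?C" if "i < k" for i
    proof -
      have next_S: "Suc i mod k \<in> S \<longleftrightarrow> Suc i \<in> S"
      proof (cases "Suc i = k")
        case True
        moreover have "0 \<notin> S" using assms(2) by (simp add: mem_S)
        moreover have "k \<notin> S" using S_sub by auto
        ultimately show ?thesis by simp
      next
        case False
        thus ?thesis using that by simp
      qed
      consider "i < 2 * r - 1" | "2 * r - 1 \<le> i" "i < r + t - 1" | "i = r + t - 1" | "r + t - 1 < i"
        by linarith
      thus ?thesis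
      proof cases
        case 1
        hence "i \<in> S \<longleftrightarrow> odd i" "Suc i \<in> S \<longleftrightarrow> even i"
          by (auto simp: mem_S)
        thus ?thesis using 1 next_S by simp
      next
        case 2
        have "i = 2 * r - 1 \<or> 2 * r \<le> i" "i < r + t" using 2 by linarith+
        hence "i \<in> S" using assms(2) by (auto simp: mem_S)
        moreover have "2 * r \<le> Suc i" "Suc i < r + t" using 2 by linarith+
        hence "Suc i \<in> S" by (simp add: mem_S)
        ultimately show ?thesis using 2 next_S by simp
      next
        case 3
        have "i = 2 * r - 1 \<or> 2 * r \<le> i" "i < r + t" using 3 assms(2,3) by linarith+
        hence "i \<in> S" using assms(2) by (auto simp: mem_S)
        moreover have "Suc i \<notin> S" using 3 assms(2,3) by (simp add: mem_S)
        ultimately show ?thesis using 3 next_S by simp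
      next
        case 4
        hence "i \<notin> S" "Suc i \<notin> S" using assms(3) by (auto simp: mem_S)
        thus ?thesis using 4 next_S assms(3) by auto
      qed
    qed
    have "\<bar>f i - f (Suc i mod k)\<bar> = (if i \<in> ?C then 1 else 0)" if "i < k" for i
    proof -
      have "Suc i mod k \<le> k" using that by (simp add: less_imp_le)
      hence "\<bar>f i - f (Suc i mod k)\<bar> = (if (i \<in> S) \<noteq> (Suc i mod k \<in> S) then 1 else 0)"
        using that by (simp add: f_def)
      thus ?thesis unfolding change[OF that] .
    qed
    hence "(\<Sum>i<k. \<bar>f i - f (Suc i mod k)\<bar>) = (\<Sum>i<k. if i \<in> ?C then 1 else 0)"
      by (intro sum.cong) auto
    also have "\<dots> = int (card ({..<k} \<inter> ?C))"
      by (simp only: sum.If_cases finite_lessThan Collect_mem_eq) simp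
    also have "{..<k} \<inter> ?C = ?C" using assms by (auto simp: k_def)
    also have "card ?C = 2 * r" using assms(2,3) by simp
    finally show ?thesis by simp
  qed
  have "(\<Sum>i<k. \<bar>f k - f i\<bar>) = sum f {..<k}"
    unfolding centre by (intro sum.cong) (auto simp: f_def)
  hence edge_sum: "sum (edge_label f) (edges (wheel_graph n)) = 2 * int r + int t"
    unfolding sum_wheel_edges[OF assms(1)] k_def[symmetric] cut_sum rim_sum by (rule arg_cong)
  have vert_sum: "sum f (verts (wheel_graph n)) = int t"
    unfolding sum_wheel_verts k_def[symmetric] centre rim_sum by simp
  show ?thesis
  proof (intro bexI[OF _ lab] conjI)
    show "Delta_v (wheel_graph n) f = \<bar>int n - 2 * int t\<bar>"
      unfolding Delta_v_wheel[OF assms(1) lab] vert_sum ..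
    show "Delta_e (wheel_graph n) f = 2 * \<bar>int n - 1 - 2 * int r - int t\<bar>"
      unfolding Delta_e_wheel[OF assms(1) lab] edge_sum by (simp only: diff_diff_add add.assoc)
  qed
qed

lemma optimal_wheel_labelling:
  assumes "n \<ge> 4"
  shows "\<exists>f \<in> labellings (wheel_graph n).
    Delta_v (wheel_graph n) f = int (n mod 2) \<and>
    Delta_e (wheel_graph n) f = (if n mod 4 = 0 then 2 else 0)"
proof -
  define q where "q = n div 4"
  have q: "q \<ge> 1" using assms by (simp add: q_def)
  have "n mod 4 < 4" by simp
  then consider "n = 4 * q" | "n = 4 * q + 1" | "n = 4 * q + 2" | "n = 4 * q + 3"
    unfolding q_def by linarith
  thus ?thesis
  proof cases
    case 1
    thus ?thesis using wheel_labelling_with_runs[of n q "2 * q"] q by simp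
  next
    case 2
    moreover have "(4 * q + 1) mod 2 = 1" by presburger
    ultimately show ?thesis
      using wheel_labelling_with_runs[OF assms, of q "2 * q"] q by simp
  next
    case 3
    moreover have "(4 * q + 2) mod 4 = 2" "(4 * q + 2) mod 2 = 0" by presburger+
    ultimately show ?thesis
      using wheel_labelling_with_runs[OF assms, of q "2 * q + 1"] q by simp
  next
    case 4
    moreover have "(4 * q + 3) mod 4 = 3" "(4 * q + 3) mod 2 = 1" by presburger+
    ultimately show ?thesis
      using wheel_labelling_with_runs[OF assms, of q "2 * q + 2"] q by simp
  qed
qed

section \<open>The two minima\<close>

theorem theorem7p1:
  fixes n :: nat
  assumes "n \<ge> 4"
  shows "D1 (wheel_graph n) =
           (if n mod 4 = 2 then 0
            else if n mod 4 = 1 \<or> n mod 4 = 3 then 1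
            else 2)
       \<and> D2 (wheel_graph n) = (if n mod 4 \<noteq> 0 then 0 else 2)"
proof -
  let ?G = "wheel_graph n"
  define a b :: int where "a = int (n mod 2)" and "b = (if n mod 4 = 0 then 2 else 0)"
  obtain f where f: "f \<in> labellings ?G" "Delta_v ?G f = a" "Delta_e ?G f = b"
    using optimal_wheel_labelling[OF assms] unfolding a_def b_def by blast
  have fin: "finite (labellings ?G)"
    using wheel_graph_simple(1)[OF assms] finite_labellings by (auto simp: finite_simple_graph_def)
  have e_lower: "b \<le> Delta_e ?G g" if "g \<in> labellings ?G" "Delta_v ?G g \<le> 1" for g
    using balanced_wheel_edge_defect[OF _ assms that]
    by (auto simp: b_def Delta_e_def dvd_eq_mod_eq_0)
  have sum_lower: "a + b \<le> Delta_v ?G g + Delta_e ?G g" if g: "g \<in> labellings ?G" for g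
  proof (cases "Delta_v ?G g \<le> 1")
    case True
    moreover have "a \<le> Delta_v ?G g"
      unfolding a_def Delta_v_wheel[OF assms g] by presburger
    ultimately show ?thesis using e_lower[OF g] by simp
  next
    case False
    moreover have "a + b \<le> 2"
      unfolding a_def b_def by (auto; presburger)
    moreover have "Delta_e ?G g \<ge> 0" by (simp add: Delta_e_def)
    ultimately show ?thesis by linarith
  qed
  have "D1 ?G = a + b"
    unfolding D1_def
  proof (rule Min_eqI)
    show "finite ((\<lambda>f. Delta_v ?G f + Delta_e ?G f) ` labellings ?G)" using fin by simp
    show "a + b \<in> (\<lambda>f. Delta_v ?G f + Delta_e ?G f) ` labellings ?G"
      using f by (intro image_eqI[of _ _ f]) auto
  qed (use sum_lower in auto)
  moreover have "D2 ?G = b"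
    unfolding D2_def
  proof (rule Min_eqI)
    show "finite (Delta_e ?G ` {f \<in> labellings ?G. Delta_v ?G f \<le> 1})" using fin by simp
    show "b \<in> Delta_e ?G ` {f \<in> labellings ?G. Delta_v ?G f \<le> 1}"
      using f by (intro image_eqI[of _ _ f]) (auto simp: a_def)
  qed (use e_lower in auto)
  moreover have "a + b = (if n mod 4 = 2 then 0 else if n mod 4 = 1 \<or> n mod 4 = 3 then 1 else 2)"
    unfolding a_def b_def by (auto; presburger)
  ultimately show ?thesis by (simp add: b_def)
qed

end
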